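(* Define $\exp_1(n)=2^n$ and $\exp_{k+1}(n)=2^{\exp_k(n)}$. For any $k\geq 1$ and $n\geq 0$, there exist a locally simple document theory $\mathcal{T}$ and a constant list $queue$, both of size linear in $k,n$, such that the terminating chase sequence for $s_0=\langle\langle\ \rangle, queue\rangle$ with respect to $\mathcal{T}$ has the form $s_0,\dots,s_m$, where $m\geq \exp_k(n)$ and $s_m=\langle model,\langle\ \rangle\rangle$ for a list $model$ with $|model|\geq \exp_k(n)$ ($|\cdot|$ = number of elements of a list).
   Context: Setting: the language of Semantic Modeling, a two-sorted first-order language (sorts "urelement" and "list") interpreted in hereditarily finite list superstructures; lists are built from urelement constants and $\langle\ \rangle$ using ${\tt cons}$ (append a new last element), ${\tt conc}$, ${\tt head}$ (last element), ${\tt tail}$ (all but the last element); bounded quantifiers; extended with conditional terms ${\tt Cond}$, search terms ${\tt bSearch}$ and bounded-recursion terms ${\tt Rec}$. Natural number $n$ = list of $n$ empty lists. Document terms are list terms built additionally from arithmetic operations and accessors to the latest ID, to documents by ID, and to field values in a model. The size of a document theory is the total size of its axioms as strings. A document theory $\mathcal{T}$ is given over pairwise disjoint finite sets $FieldNames$, $FormNames$ (non-empty), $FilterNames$, $TransNames$ of constants. Fields are lists (head = field name, tail = value), documents are lists of fields. $\mathcal{T}$ specifies cardinality restrictions on field values, a blank document with default values for each form, and filters $GetDocsByFilter_{name}(fName, model, params)$ returning IDs of last versions of documents of form $fName$ in $model$ satisfying a Boolean combination of $<,=$ comparisons of document terms. Instructions: $\langle formName, CreateDoc\rangle$, $\langle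 value, fieldName, docID, SetField\rangle$, transactions $\langle params, docID, transName\rangle$. A model is a list of tuples $\langle sit, form, doc, ID\rangle$; a queue is a list of instructions. $Update(initialmodel, model, queue)$ processes the first instruction: empty queue returns $model$; invalid instruction returns $initialmodel$; CreateDoc appends a blank document of that form with a fresh ID and removes the instruction; SetField (if valid, otherwise return $initialmodel$) appends a new version of the document with the updated value and replaces the remaining queue by $SetFieldTrigger(docID, fieldName, value, {\tt tail}(queue), model)$; a transaction keeps the model and replaces the remaining queue by $ExecTrans(transName, docID, params, {\tt tail}(queue), model)$; then recursion. The daemons $SetFieldTrigger$, $ExecTrans$ are ${\tt Cond}[\theta_1,q_1]\dots[\theta_n,q_n][queue]$ terms. Conditions of $SetFieldTrigger$ are $(formName, fieldName)$-conditions ("document $docID$ has form $formName$, the changed field is $fieldName$, and $\varphi$"); conditions of $ExecTrans$ are $(formName, transName)$-conditions, $\varphi$ a Boolean combination of comparisons of document terms. Each $q_i={\tt conc}(queue, instr_i)$, the queue extension being a concatenation of instruction terms: a single SetField instruction on field $fieldName'$ of document $docID$ (a $(formName, fieldName')$-instruction); a ${\tt Rec}$-term emitting, for every ID in a filter result on form $frmName$, a transaction named $transName$ (a $(frmName, transName)$-instruction); and, only in $ExecTrans$, a single $\langle frmName, CreateDoc\rangle$ or one per ID of a filter result on form $frmName$ (a $(frmName, CreateDoc)$-instruction). Chase: $\langle model, queue\rangle\mapsto\langle model', queue'\rangle$ denotes one non-recursive unfolding step of $Update$ on the first instruction of a non-empty queue. A chase sequence is a sequence of such steps; it is terminating if it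 is finite, $s_0,\dots,s_k$ with $k\ge1$, and $s_k=\langle m_k,\langle\ \rangle\rangle$. Dependency graph of $\mathcal{T}$: vertices $FormNames\times(FieldNames\cup TransNames\cup\{CreateDoc\})$, edge from $(form,name)$ to $(form',name')$ iff some daemon branch with a $(form,name)$-condition has a queue extension containing a $(form',name')$-instruction. $\mathcal{T}$ is locally simple if this graph is acyclic. *)

theory Defs
  imports Main
begin

section \<open>Hereditarily finite lists\<close>

datatype urelem = CreateDoc | SetField | Name nat

datatype elem = Ur urelem | Lst "elem list"

text \<open>
  Lists grow at the right end: \<open>cons\<close> appends a last element, the head of a list is its last
  element and its tail is everything but the last element.  List operations see an urelement as
  the empty list, and head and tail of the empty list are the empty list.
\<close>

fun els :: "elem \<Rightarrow> elem list" where
  "els (Ur u) = []"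
| "els (Lst xs) = xs"

definition list_cons :: "elem \<Rightarrow> elem \<Rightarrow> elem" where
  "list_cons a b = Lst (els a @ [b])"

definition list_conc :: "elem \<Rightarrow> elem \<Rightarrow> elem" where
  "list_conc a b = Lst (els a @ els b)"

definition list_head :: "elem \<Rightarrow> elem" where
  "list_head a = (if els a = [] then Lst [] else last (els a))"

definition list_tail :: "elem \<Rightarrow> elem" where
  "list_tail a = Lst (butlast (els a))"

definition num :: "nat \<Rightarrow> elem" where
  "num n = Lst (replicate n (Lst []))"

definition is_num :: "elem \<Rightarrow> bool" where
  "is_num a \<longleftrightarrow> (\<exists>n. a = num n)"

definition num_less :: "elem \<Rightarrow> elem \<Rightarrow> bool" where
  "num_less a b \<longleftrightarrow> (\<exists>m n. a = num m \<and> b = num n \<and> m < n)"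

section \<open>Models\<close>

text \<open>
  A model is a list of tuples \<open>\<langle>sit, form, doc, ID\<rangle>\<close>, each of which is a version of the document with
  this ID; later tuples are later versions.
\<close>

fun version_id :: "elem \<Rightarrow> elem option" where
  "version_id (Lst [s, f, d, i]) = Some i"
| "version_id _ = None"

definition version_ids :: "elem list \<Rightarrow> elem list" where
  "version_ids m = List.map_filter version_id m"

text \<open>The IDs in the order of the last versions (\<open>remdups\<close> keeps last occurrences).\<close>

definition last_version_ids :: "elem list \<Rightarrow> elem list" where
  "last_version_ids m = remdups (version_ids m)"

definition last_version :: "elem \<Rightarrow> elem list \<Rightarrow> elem option" where
  "last_version i m = List.find (\<lambda>e. version_id e = Some i) (rev m)"

definition get_form :: "elem \<Rightarrow> elem list \<Rightarrow> elem" where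
  "get_form i m = (case last_version i m of Some (Lst [s, f, d, j]) \<Rightarrow> f | _ \<Rightarrow> Lst [])"

definition get_doc :: "elem \<Rightarrow> elem list \<Rightarrow> elem" where
  "get_doc i m = (case last_version i m of Some (Lst [s, f, d, j]) \<Rightarrow> d | _ \<Rightarrow> Lst [])"

text \<open>A document is a list of fields; a field is its value with the field name appended.\<close>

definition find_field :: "elem \<Rightarrow> elem \<Rightarrow> elem option" where
  "find_field n d = List.find (\<lambda>fld. list_head fld = n) (els d)"

definition get_field_value :: "elem \<Rightarrow> elem \<Rightarrow> elem list \<Rightarrow> elem" where
  "get_field_value n i m =
     (case find_field n (get_doc i m) of Some fld \<Rightarrow> list_tail fld | None \<Rightarrow> Lst [])"

definition update_doc :: "urelem \<Rightarrow> elem \<Rightarrow> elem \<Rightarrow> elem" where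
  "update_doc n v d =
     Lst (map (\<lambda>fld. if list_head fld = Ur n then list_cons v (Ur n) else fld) (els d))"

definition last_id :: "elem list \<Rightarrow> nat" where
  "last_id m = Max (insert 0 {n. num n \<in> set (version_ids m)})"

section \<open>Document terms and their Boolean combinations\<close>

datatype var = ModelV | QueueV | DocIDV | FieldV | ValueV | TransV | ParamsV | FormV | ElemV

datatype arith = Plus | Minus | Times | Div

datatype dterm =
    V var
  | C urelem
  | Empty
  | Cons dterm dterm
  | Conc dterm dterm
  | Head dterm
  | Tail dterm
  | Arith arith dterm dterm
  | LastID dterm
  | DocByID dterm dterm
  | FieldValue dterm dterm dterm

datatype dfml =
    Less dterm dterm
  | Equal dterm dterm
  | Neg dfml
  | Conj dfml dfml
  | Disj dfml dfml

type_synonym env = "var \<Rightarrow> elem"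

fun arith_op :: "arith \<Rightarrow> nat \<Rightarrow> nat \<Rightarrow> nat" where
  "arith_op Plus m n = m + n"
| "arith_op Minus m n = m - n"
| "arith_op Times m n = m * n"
| "arith_op Div m n = m div n"

definition arith_elem :: "arith \<Rightarrow> elem \<Rightarrow> elem \<Rightarrow> elem" where
  "arith_elem p a b =
     (if is_num a \<and> is_num b then num (arith_op p (length (els a)) (length (els b))) else Lst [])"

primrec eval :: "env \<Rightarrow> dterm \<Rightarrow> elem" where
  "eval e (V x) = e x"
| "eval e (C u) = Ur u"
| "eval e Empty = Lst []"
| "eval e (Cons s t) = list_cons (eval e s) (eval e t)"
| "eval e (Conc s t) = list_conc (eval e s) (eval e t)"
| "eval e (Head t) = list_head (eval e t)"
| "eval e (Tail t) = list_tail (eval e t)"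
| "eval e (Arith p s t) = arith_elem p (eval e s) (eval e t)"
| "eval e (LastID t) = num (last_id (els (eval e t)))"
| "eval e (DocByID i t) = get_doc (eval e i) (els (eval e t))"
| "eval e (FieldValue n i t) = get_field_value (eval e n) (eval e i) (els (eval e t))"

primrec holds :: "env \<Rightarrow> dfml \<Rightarrow> bool" where
  "holds e (Less s t) \<longleftrightarrow> num_less (eval e s) (eval e t)"
| "holds e (Equal s t) \<longleftrightarrow> eval e s = eval e t"
| "holds e (Neg p) \<longleftrightarrow> \<not> holds e p"
| "holds e (Conj p q) \<longleftrightarrow> holds e p \<and> holds e q"
| "holds e (Disj p q) \<longleftrightarrow> holds e p \<or> holds e q"

primrec term_vars :: "dterm \<Rightarrow> var set" where
  "term_vars (V x) = {x}"
| "term_vars (C u) = {}"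
| "term_vars Empty = {}"
| "term_vars (Cons s t) = term_vars s \<union> term_vars t"
| "term_vars (Conc s t) = term_vars s \<union> term_vars t"
| "term_vars (Head t) = term_vars t"
| "term_vars (Tail t) = term_vars t"
| "term_vars (Arith p s t) = term_vars s \<union> term_vars t"
| "term_vars (LastID t) = term_vars t"
| "term_vars (DocByID i t) = term_vars i \<union> term_vars t"
| "term_vars (FieldValue n i t) = term_vars n \<union> term_vars i \<union> term_vars t"

primrec fml_vars :: "dfml \<Rightarrow> var set" where
  "fml_vars (Less s t) = term_vars s \<union> term_vars t"
| "fml_vars (Equal s t) = term_vars s \<union> term_vars t"
| "fml_vars (Neg p) = fml_vars p"
| "fml_vars (Conj p q) = fml_vars p \<union> fml_vars q"
| "fml_vars (Disj p q) = fml_vars p \<union> fml_vars q"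

section \<open>Document theories\<close>

text \<open>
  Instruction terms.  \<open>SetInstr fld v\<close> sets the field of the document \<open>docID\<close>;
  \<open>TransEach flt fp frm tr p\<close> and \<open>CreateEach flt fp frm\<close> emit one instruction for each ID in the
  result of filter \<open>flt\<close> with parameters \<open>fp\<close> on form \<open>frm\<close>; in the term \<open>p\<close> for the parameters
  of the transaction this ID is available as \<open>ElemV\<close>.
\<close>

datatype instr =
    SetInstr urelem dterm
  | TransEach urelem dterm urelem urelem dterm
  | CreateOne urelem
  | CreateEach urelem dterm urelem

text \<open>
  A branch \<open>[\<theta>, conc(queue, ext)]\<close> of a daemon, where \<open>\<theta>\<close> is the \<open>(form, name)\<close>-condition given by
  \<open>br_form\<close>, \<open>br_name\<close> and the additional condition \<open>br_cond\<close>.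
\<close>

record branch =
  br_form :: urelem
  br_name :: urelem
  br_cond :: dfml
  br_ext :: "instr list"

text \<open>
  The sets of names are given by enumerations.  \<open>cardinality\<close> bounds the number of elements of
  the value of a field from below and, unless it is \<open>None\<close>, from above.
\<close>

record doc_theory =
  field_names :: "urelem list"
  form_names :: "urelem list"
  filter_names :: "urelem list"
  trans_names :: "urelem list"
  cardinality :: "urelem \<Rightarrow> nat \<times> nat option"
  blank_doc :: "urelem \<Rightarrow> elem"
  filter_cond :: "urelem \<Rightarrow> dfml"
  trigger_branches :: "branch list"
  trans_branches :: "branch list"

definition within_cardinality :: "doc_theory \<Rightarrow> urelem \<Rightarrow> elem \<Rightarrow> bool" where
  "within_cardinality T n v \<longleftrightarrow>
     (\<exists>vs. v = Lst vs \<and> fst (cardinality T n) \<le> length vs \<and>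
        (case snd (cardinality T n) of None \<Rightarrow> True | Some u \<Rightarrow> length vs \<le> u))"

definition blank_doc_ok :: "doc_theory \<Rightarrow> elem \<Rightarrow> bool" where
  "blank_doc_ok T d \<longleftrightarrow>
     (\<exists>flds. d = Lst flds \<and> distinct (map list_head flds) \<and>
        (\<forall>fld \<in> set flds. \<exists>n \<in> set (field_names T). \<exists>v.
           within_cardinality T n v \<and> fld = list_cons v (Ur n)))"

definition filter_vars :: "var set" where
  "filter_vars = {FormV, ModelV, ParamsV, DocIDV}"

definition trigger_vars :: "var set" where
  "trigger_vars = {DocIDV, FieldV, ValueV, QueueV, ModelV}"

definition trans_vars :: "var set" where
  "trans_vars = {TransV, DocIDV, ParamsV, QueueV, ModelV}"

primrec instr_ok :: "doc_theory \<Rightarrow> var set \<Rightarrow> instr \<Rightarrow> bool" where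
  "instr_ok T X (SetInstr fld v) \<longleftrightarrow> fld \<in> set (field_names T) \<and> term_vars v \<subseteq> X"
| "instr_ok T X (TransEach flt fp frm tr p) \<longleftrightarrow>
     flt \<in> set (filter_names T) \<and> term_vars fp \<subseteq> X \<and> frm \<in> set (form_names T) \<and>
     tr \<in> set (trans_names T) \<and> term_vars p \<subseteq> insert ElemV X"
| "instr_ok T X (CreateOne frm) \<longleftrightarrow> frm \<in> set (form_names T)"
| "instr_ok T X (CreateEach flt fp frm) \<longleftrightarrow>
     flt \<in> set (filter_names T) \<and> term_vars fp \<subseteq> X \<and> frm \<in> set (form_names T)"

primrec is_create :: "instr \<Rightarrow> bool" where
  "is_create (SetInstr fld v) \<longleftrightarrow> False"
| "is_create (TransEach flt fp frm tr p) \<longleftrightarrow> False"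
| "is_create (CreateOne frm) \<longleftrightarrow> True"
| "is_create (CreateEach flt fp frm) \<longleftrightarrow> True"

definition branch_ok :: "doc_theory \<Rightarrow> urelem list \<Rightarrow> var set \<Rightarrow> branch \<Rightarrow> bool" where
  "branch_ok T ns X b \<longleftrightarrow>
     br_form b \<in> set (form_names T) \<and> br_name b \<in> set ns \<and> fml_vars (br_cond b) \<subseteq> X \<and>
     br_ext b \<noteq> [] \<and> (\<forall>i \<in> set (br_ext b). instr_ok T X i)"

definition document_theory :: "doc_theory \<Rightarrow> bool" where
  "document_theory T \<longleftrightarrow>
     distinct (CreateDoc # SetField #
       field_names T @ form_names T @ filter_names T @ trans_names T) \<and>
     form_names T \<noteq> [] \<and>
     (\<forall>f \<in> set (form_names T). blank_doc_ok T (blank_doc T f)) \<and>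
     (\<forall>f \<in> set (filter_names T). fml_vars (filter_cond T f) \<subseteq> filter_vars) \<and>
     (\<forall>b \<in> set (trigger_branches T).
        branch_ok T (field_names T) trigger_vars b \<and> (\<forall>i \<in> set (br_ext b). \<not> is_create i)) \<and>
     (\<forall>b \<in> set (trans_branches T). branch_ok T (trans_names T) trans_vars b)"

section \<open>Semantics of filters and daemons\<close>

fun Cond :: "(bool \<times> 'a) list \<Rightarrow> 'a \<Rightarrow> 'a" where
  "Cond [] q = q"
| "Cond ((\<theta>, q') # bs) q = (if \<theta> then q' else Cond bs q)"

text \<open>\<open>Rec f h t\<close>: \<open>g(\<langle>\<rangle>) = f\<close> and \<open>g(cons(\<alpha>, b)) = h(g(\<alpha>), b)\<close>, evaluated at \<open>t\<close>.\<close>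

definition Rec :: "'a \<Rightarrow> ('a \<Rightarrow> elem \<Rightarrow> 'a) \<Rightarrow> elem list \<Rightarrow> 'a" where
  "Rec f h t = foldl h f t"

definition empty_env :: env where
  "empty_env = (\<lambda>_. Lst [])"

definition docs_by_filter ::
    "doc_theory \<Rightarrow> urelem \<Rightarrow> urelem \<Rightarrow> elem list \<Rightarrow> elem \<Rightarrow> elem list" where
  "docs_by_filter T flt frm m p =
     filter (\<lambda>i. get_form i m = Ur frm \<and>
         holds (empty_env(FormV := Ur frm, ModelV := Lst m, ParamsV := p, DocIDV := i))
           (filter_cond T flt))
       (last_version_ids m)"

definition create_instr :: "urelem \<Rightarrow> elem" where
  "create_instr frm = Lst [Ur frm, Ur CreateDoc]"

definition set_instr :: "elem \<Rightarrow> urelem \<Rightarrow> elem \<Rightarrow> elem" where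
  "set_instr v fld i = Lst [v, Ur fld, i, Ur SetField]"

definition trans_instr :: "elem \<Rightarrow> elem \<Rightarrow> urelem \<Rightarrow> elem" where
  "trans_instr p i tr = Lst [p, i, Ur tr]"

primrec emit :: "doc_theory \<Rightarrow> elem list \<Rightarrow> env \<Rightarrow> instr \<Rightarrow> elem list" where
  "emit T m e (SetInstr fld v) = [set_instr (eval e v) fld (e DocIDV)]"
| "emit T m e (TransEach flt fp frm tr p) =
     Rec [] (\<lambda>acc i. acc @ [trans_instr (eval (e(ElemV := i)) p) i tr])
       (docs_by_filter T flt frm m (eval e fp))"
| "emit T m e (CreateOne frm) = [create_instr frm]"
| "emit T m e (CreateEach flt fp frm) =
     Rec [] (\<lambda>acc i. acc @ [create_instr frm]) (docs_by_filter T flt frm m (eval e fp))"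

definition extension :: "doc_theory \<Rightarrow> elem list \<Rightarrow> env \<Rightarrow> instr list \<Rightarrow> elem list" where
  "extension T m e is = concat (map (emit T m e) is)"

definition set_field_trigger ::
    "doc_theory \<Rightarrow> elem \<Rightarrow> urelem \<Rightarrow> elem \<Rightarrow> elem list \<Rightarrow> elem list \<Rightarrow> elem list" where
  "set_field_trigger T i fld v q m =
     (let e = empty_env(DocIDV := i, FieldV := Ur fld, ValueV := v, QueueV := Lst q, ModelV := Lst m)
      in Cond (map (\<lambda>b. (get_form i m = Ur (br_form b) \<and> fld = br_name b \<and> holds e (br_cond b),
                         q @ extension T m e (br_ext b)))
                   (trigger_branches T)) q)"

definition exec_trans ::
    "doc_theory \<Rightarrow> urelem \<Rightarrow> elem \<Rightarrow> elem \<Rightarrow> elem list \<Rightarrow> elem list \<Rightarrow> elem list" where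
  "exec_trans T tr i p q m =
     (let e = empty_env(TransV := Ur tr, DocIDV := i, ParamsV := p, QueueV := Lst q, ModelV := Lst m)
      in Cond (map (\<lambda>b. (get_form i m = Ur (br_form b) \<and> tr = br_name b \<and> holds e (br_cond b),
                         q @ extension T m e (br_ext b)))
                   (trans_branches T)) q)"

section \<open>Chase\<close>

type_synonym state = "elem list \<times> elem list"

text \<open>
  A new version gets as situation the number of tuples already in the model, a new document gets
  as ID the successor of the latest ID.
\<close>

definition create_doc :: "doc_theory \<Rightarrow> urelem \<Rightarrow> elem list \<Rightarrow> elem list" where
  "create_doc T frm m =
     m @ [Lst [num (length m), Ur frm, blank_doc T frm, num (Suc (last_id m))]]"

definition set_field :: "elem \<Rightarrow> urelem \<Rightarrow> elem \<Rightarrow> elem list \<Rightarrow> elem list" where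
  "set_field v fld i m =
     m @ [Lst [num (length m), get_form i m, update_doc fld v (get_doc i m), i]]"

definition set_field_valid :: "doc_theory \<Rightarrow> elem \<Rightarrow> urelem \<Rightarrow> elem \<Rightarrow> elem list \<Rightarrow> bool" where
  "set_field_valid T v fld i m \<longleftrightarrow>
     fld \<in> set (field_names T) \<and> i \<in> set (version_ids m) \<and>
     find_field (Ur fld) (get_doc i m) \<noteq> None \<and> within_cardinality T fld v"

text \<open>
  The unfolding of \<open>Update(initialmodel, model, queue)\<close> for a non-empty queue.  The first
  instruction is the head, i.e. the last element, of the queue.  An invalid instruction makes
  \<open>Update\<close> return \<open>initialmodel\<close>: nothing remains to be processed.
\<close>

definition update_step :: "doc_theory \<Rightarrow> elem list \<Rightarrow> elem list \<Rightarrow> elem list \<Rightarrow> state" where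
  "update_step T init m q =
     (let r = butlast q in
      case last q of
        Lst [Ur frm, Ur CreateDoc] \<Rightarrow>
          if frm \<in> set (form_names T) then (create_doc T frm m, r) else (init, [])
      | Lst [v, Ur fld, i, Ur SetField] \<Rightarrow>
          if set_field_valid T v fld i m
          then (set_field v fld i m, set_field_trigger T i fld v r m) else (init, [])
      | Lst [p, i, Ur tr] \<Rightarrow>
          if tr \<in> set (trans_names T) \<and> i \<in> set (version_ids m)
          then (m, exec_trans T tr i p r m) else (init, [])
      | _ \<Rightarrow> (init, []))"

definition chase_step :: "doc_theory \<Rightarrow> elem list \<Rightarrow> state \<Rightarrow> state \<Rightarrow> bool" where
  "chase_step T init s s' \<longleftrightarrow> snd s \<noteq> [] \<and> s' = update_step T init (fst s) (snd s)"

text \<open>The initial model is the model of the first state of the sequence.\<close>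

definition chase_sequence :: "doc_theory \<Rightarrow> state list \<Rightarrow> bool" where
  "chase_sequence T ss \<longleftrightarrow>
     ss \<noteq> [] \<and> (\<forall>j. Suc j < length ss \<longrightarrow> chase_step T (fst (hd ss)) (ss ! j) (ss ! Suc j))"

definition terminating_chase_sequence :: "doc_theory \<Rightarrow> state \<Rightarrow> state list \<Rightarrow> bool" where
  "terminating_chase_sequence T s ss \<longleftrightarrow>
     chase_sequence T ss \<and> hd ss = s \<and> length ss \<ge> 2 \<and> snd (last ss) = []"

section \<open>Locally simple theories\<close>

text \<open>The vertex \<open>(form, name)\<close> of an instruction in a branch with a condition on \<open>frm\<close>.\<close>

primrec instr_vertex :: "urelem \<Rightarrow> instr \<Rightarrow> urelem \<times> urelem" where
  "instr_vertex frm (SetInstr fld v) = (frm, fld)"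
| "instr_vertex frm (TransEach flt fp frm' tr p) = (frm', tr)"
| "instr_vertex frm (CreateOne frm') = (frm', CreateDoc)"
| "instr_vertex frm (CreateEach flt fp frm') = (frm', CreateDoc)"

definition dependency_graph :: "doc_theory \<Rightarrow> ((urelem \<times> urelem) \<times> (urelem \<times> urelem)) set" where
  "dependency_graph T =
     {((br_form b, br_name b), instr_vertex (br_form b) i) | b i.
        b \<in> set (trigger_branches T @ trans_branches T) \<and> i \<in> set (br_ext b)}"

definition locally_simple :: "doc_theory \<Rightarrow> bool" where
  "locally_simple T \<longleftrightarrow> acyclic (dependency_graph T)"

section \<open>Sizes\<close>

text \<open>
  Terms and axioms are written as strings over an alphabet which has every constant, every
  variable, every function symbol and every punctuation mark as one letter.
\<close>

datatype token = ConstT urelem | VarT var | Sym string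

fun commas :: "token list list \<Rightarrow> token list" where
  "commas [] = []"
| "commas [x] = x"
| "commas (x # y # zs) = x @ Sym '','' # commas (y # zs)"

definition tuple_str :: "token list list \<Rightarrow> token list" where
  "tuple_str xs = Sym ''<'' # commas xs @ [Sym ''>'']"

definition app_str :: "string \<Rightarrow> token list list \<Rightarrow> token list" where
  "app_str f xs = Sym f # Sym ''('' # commas xs @ [Sym '')'']"

definition infix_str :: "token list \<Rightarrow> string \<Rightarrow> token list \<Rightarrow> token list" where
  "infix_str x p y = Sym ''('' # x @ Sym p # y @ [Sym '')'']"

primrec elem_str :: "elem \<Rightarrow> token list" where
  "elem_str (Ur u) = [ConstT u]"
| "elem_str (Lst xs) = tuple_str (map elem_str xs)"

primrec arith_name :: "arith \<Rightarrow> string" where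
  "arith_name Plus = ''+''"
| "arith_name Minus = ''-''"
| "arith_name Times = ''*''"
| "arith_name Div = ''div''"

primrec term_str :: "dterm \<Rightarrow> token list" where
  "term_str (V x) = [VarT x]"
| "term_str (C u) = [ConstT u]"
| "term_str Empty = tuple_str []"
| "term_str (Cons s t) = app_str ''cons'' [term_str s, term_str t]"
| "term_str (Conc s t) = app_str ''conc'' [term_str s, term_str t]"
| "term_str (Head t) = app_str ''head'' [term_str t]"
| "term_str (Tail t) = app_str ''tail'' [term_str t]"
| "term_str (Arith p s t) = infix_str (term_str s) (arith_name p) (term_str t)"
| "term_str (LastID t) = app_str ''GetLastID'' [term_str t]"
| "term_str (DocByID i t) = app_str ''GetDocByID'' [term_str i, term_str t]"
| "term_str (FieldValue n i t) = app_str ''GetFieldValue'' [term_str n, term_str i, term_str t]"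

primrec fml_str :: "dfml \<Rightarrow> token list" where
  "fml_str (Less s t) = infix_str (term_str s) ''<'' (term_str t)"
| "fml_str (Equal s t) = infix_str (term_str s) ''='' (term_str t)"
| "fml_str (Neg p) = app_str ''not'' [fml_str p]"
| "fml_str (Conj p q) = infix_str (fml_str p) ''and'' (fml_str q)"
| "fml_str (Disj p q) = infix_str (fml_str p) ''or'' (fml_str q)"

definition form_cond_str :: "token \<Rightarrow> token list" where
  "form_cond_str frm = infix_str (app_str ''GetForm'' [[VarT DocIDV], [VarT ModelV]]) ''='' [frm]"

definition filter_str :: "urelem \<Rightarrow> token list list \<Rightarrow> token list" where
  "filter_str flt xs = Sym ''GetDocsByFilter'' # ConstT flt # Sym ''('' # commas xs @ [Sym '')'']"

text \<open>
  The string \<open>Rec[<>, cons(acc, x), t]\<close>; the accumulator \<open>acc\<close> is bound by \<open>Rec\<close>.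
\<close>

definition rec_str :: "token list \<Rightarrow> token list \<Rightarrow> token list" where
  "rec_str x t =
     Sym ''Rec'' # Sym ''['' #
     commas [tuple_str [], app_str ''cons'' [[Sym ''acc''], x], t] @ [Sym '']'']"

primrec instr_str :: "instr \<Rightarrow> token list" where
  "instr_str (SetInstr fld v) =
     tuple_str [tuple_str [term_str v, [ConstT fld], [VarT DocIDV], [ConstT SetField]]]"
| "instr_str (TransEach flt fp frm tr p) =
     rec_str (tuple_str [term_str p, [VarT ElemV], [ConstT tr]])
       (filter_str flt [[ConstT frm], [VarT ModelV], term_str fp])"
| "instr_str (CreateOne frm) = tuple_str [tuple_str [[ConstT frm], [ConstT CreateDoc]]]"
| "instr_str (CreateEach flt fp frm) =
     rec_str (tuple_str [[ConstT frm], [ConstT CreateDoc]])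
       (filter_str flt [[ConstT frm], [VarT ModelV], term_str fp])"

definition branch_str :: "var \<Rightarrow> branch \<Rightarrow> token list" where
  "branch_str x b =
     Sym ''['' #
     infix_str (infix_str (form_cond_str (ConstT (br_form b))) ''and''
                  (infix_str [VarT x] ''='' [ConstT (br_name b)]))
       ''and'' (fml_str (br_cond b)) @
     Sym '','' #
     foldl (\<lambda>s i. app_str ''conc'' [s, instr_str i]) [VarT QueueV] (br_ext b) @
     [Sym '']'']"

definition daemon_axiom :: "string \<Rightarrow> var list \<Rightarrow> var \<Rightarrow> branch list \<Rightarrow> token list" where
  "daemon_axiom name xs x bs =
     app_str name (map (\<lambda>y. [VarT y]) xs) @ Sym ''='' # Sym ''Cond'' #
     concat (map (branch_str x) bs) @ [Sym ''['', VarT QueueV, Sym '']'']"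

definition names_axiom :: "string \<Rightarrow> urelem list \<Rightarrow> token list" where
  "names_axiom s ns = Sym s # Sym ''='' # tuple_str (map (\<lambda>n. [ConstT n]) ns)"

definition cardinality_axiom :: "doc_theory \<Rightarrow> urelem \<Rightarrow> token list" where
  "cardinality_axiom T n =
     app_str ''Cardinality'' [[ConstT n]] @ Sym ''='' #
     tuple_str [elem_str (num (fst (cardinality T n))),
       (case snd (cardinality T n) of None \<Rightarrow> [Sym ''inf''] | Some u \<Rightarrow> elem_str (num u))]"

definition blank_doc_axiom :: "doc_theory \<Rightarrow> urelem \<Rightarrow> token list" where
  "blank_doc_axiom T f =
     app_str ''BlankDoc'' [[ConstT f]] @ Sym ''='' # elem_str (blank_doc T f)"

text \<open>
  \<open>GetDocsByFilter_flt(fName, model, params) =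
     Rec[<>, Cond[GetForm(docID, model) = fName and \<phi>, cons(acc, docID)][acc], LastVersionIDs(model)]\<close>
\<close>

definition filter_axiom :: "doc_theory \<Rightarrow> urelem \<Rightarrow> token list" where
  "filter_axiom T flt =
     filter_str flt [[VarT FormV], [VarT ModelV], [VarT ParamsV]] @ Sym ''='' #
     Sym ''Rec'' # Sym ''['' #
     commas [tuple_str [],
       Sym ''Cond'' # Sym ''['' #
         infix_str (form_cond_str (VarT FormV)) ''and'' (fml_str (filter_cond T flt)) @
         Sym '','' # app_str ''cons'' [[Sym ''acc''], [VarT DocIDV]] @
         [Sym '']'', Sym ''['', Sym ''acc'', Sym '']''],
       app_str ''LastVersionIDs'' [[VarT ModelV]]] @
     [Sym '']'']"

text \<open>
  The axioms by which document theories differ.  The axioms defining \<open>Update\<close> and the accessors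
  are the same for all theories; they would add the same constant to the size of each theory.
\<close>

definition axioms :: "doc_theory \<Rightarrow> token list list" where
  "axioms T =
     [names_axiom ''FieldNames'' (field_names T), names_axiom ''FormNames'' (form_names T),
      names_axiom ''FilterNames'' (filter_names T), names_axiom ''TransNames'' (trans_names T)] @
     map (cardinality_axiom T) (field_names T) @
     map (blank_doc_axiom T) (form_names T) @
     map (filter_axiom T) (filter_names T) @
     [daemon_axiom ''SetFieldTrigger'' [DocIDV, FieldV, ValueV, QueueV, ModelV] FieldV
        (trigger_branches T),
      daemon_axiom ''ExecTrans'' [TransV, DocIDV, ParamsV, QueueV, ModelV] TransV
        (trans_branches T)]"

definition theory_size :: "doc_theory \<Rightarrow> nat" where
  "theory_size T = sum_list (map length (axioms T))"

definition list_size :: "elem list \<Rightarrow> nat" where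
  "list_size q = length (elem_str (Lst q))"

section \<open>Iterated exponentials\<close>

primrec iter_exp :: "nat \<Rightarrow> nat \<Rightarrow> nat" where
  "iter_exp 0 n = n"
| "iter_exp (Suc k) n = 2 ^ iter_exp k n"

end

theory Submission
  imports Defs
begin

text \<open>
  Documents of form \<open>F i\<close> (\<open>i \<le> k\<close>) serve as unary counters.  The transaction \<open>double\<close> on any
  document of form \<open>F i\<close> creates one document of form \<open>F (i+1)\<close> for each existing one, hence
  doubles their number.  The transaction \<open>stage i\<close> creates a first document of form \<open>F (i+1)\<close> and then
  issues \<open>double\<close> on every document of form \<open>F i\<close>, so \<open>N\<close> documents of form \<open>F i\<close> yield \<open>2^N\<close>
  documents of form \<open>F (i+1)\<close>.  The queue creates \<open>n + 1\<close> documents of form \<open>F 0\<close> and runs the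
  stages \<open>0, \<dots>, k - 1\<close>, all on the document with ID \<open>1\<close>, so that each instruction has constant
  size.  Stages issue only \<open>double\<close> and \<open>CreateDoc\<close>, \<open>double\<close> issues only \<open>CreateDoc\<close>, and
  \<open>CreateDoc\<close> triggers nothing, so the dependency graph is acyclic.
\<close>

section \<open>Chase sequences\<close>

text \<open>\<open>Cond\<close> takes the first true branch. When all true branches carry the same
  value, a daemon can be evaluated without locating the branch in the list.\<close>

lemma Cond_unique:
  assumes "(True, x) \<in> set bs" "\<And>y. (True, y) \<in> set bs \<Longrightarrow> y = x"
  shows "Cond bs q = x"
  using assms
proof (induction bs)
  case (Cons b bs)
  obtain \<theta> y where b: "b = (\<theta>, y)" by (cases b)
  show ?case
  proof (cases \<theta>)
    case True
    then show ?thesis using Cons.prems(2)[of y] b by simp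
  next
    case False
    then have "(True, x) \<in> set bs" using Cons.prems(1) b by simp
    moreover have "y = x" if "(True, y) \<in> set bs" for y
      using Cons.prems(2) that by (meson list.set_intros(2))
    ultimately have "Cond bs q = x" by (rule Cons.IH)
    then show ?thesis using False b by simp
  qed
qed simp

lemma Rec_append_singleton: "Rec [] (\<lambda>acc i. acc @ [f i]) xs = map f xs"
proof -
  have "foldl (\<lambda>acc i. acc @ [f i]) ys xs = ys @ map f xs" for ys
    by (induction xs arbitrary: ys) auto
  then show ?thesis by (simp add: Rec_def)
qed

lemma count_list_replicate: "count_list (replicate m x) x = m"
  by (induction m) auto

text \<open>A step appends one tuple, keeps the model, or falls back to the initial model, which is
  empty here. Hence a large final model already forces a long chase and steps need not be
  counted.\<close>

lemma length_update_step: "length (fst (update_step T [] m q)) \<le> Suc (length m)"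
proof -
  \<comment> \<open>With the bound folded into a predicate, introduction rules can follow the nested
    case distinctions of \<open>update_step\<close> down to the resulting states.\<close>
  define short where "short = (\<lambda>s :: state. length (fst s) \<le> Suc (length m))"
  have cases: "\<And>f g z. (\<And>u. short (f u)) \<Longrightarrow> (\<And>xs. short (g xs)) \<Longrightarrow> short (case_elem f g z)"
    "\<And>f g z. short f \<Longrightarrow> (\<And>x xs. short (g x xs)) \<Longrightarrow> short (case_list f g (z :: elem list))"
    "\<And>f g h z. short f \<Longrightarrow> short g \<Longrightarrow> (\<And>n. short (h n)) \<Longrightarrow> short (case_urelem f g h z)"
    "\<And>P s t. short s \<Longrightarrow> short t \<Longrightarrow> short (if P then s else t)"
    by (simp_all split: elem.split list.split urelem.split)
  have states: "short ([], p)" "short (m, p)" "short (create_doc T frm m, p)"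
    "short (set_field v fld i m, p)" for p frm v fld i
    by (simp_all add: short_def create_doc_def set_field_def)
  have "short (update_step T [] m q)"
    unfolding update_step_def Let_def by (intro cases states)
  then show ?thesis by (simp add: short_def)
qed

lemma length_chase_steps:
  assumes "(chase_step T [] ^^ j) s s'"
  shows "length (fst s') \<le> length (fst s) + j"
  using assms
proof (induction j arbitrary: s')
  case (Suc j)
  then obtain t where "(chase_step T [] ^^ j) s t" "chase_step T [] t s'" by auto
  moreover from this(2) have "length (fst s') \<le> Suc (length (fst t))"
    using length_update_step by (auto simp: chase_step_def)
  ultimately show ?case using Suc.IH[of t] by simp
qed simp

text \<open>A step is a function of the state and is impossible on an empty queue. So any
  terminating sequence follows the given run and can neither stop before it nor continue after
  it.\<close>

lemma unique_terminating_chase: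
  assumes "(chase_step T (fst s) ^^ m) s (model, [])" "snd s \<noteq> []"
  obtains ss where "\<And>ss'. terminating_chase_sequence T s ss' \<longleftrightarrow> ss' = ss"
    "length ss = Suc m" "ss ! m = (model, [])"
proof -
  obtain f where f: "f 0 = s" "f m = (model, [])"
    "\<And>i. i < m \<Longrightarrow> chase_step T (fst s) (f i) (f (Suc i))"
    using assms(1) by (auto simp: relpowp_fun_conv)
  \<comment> \<open>A terminating sequence needs at least two states; the non-empty initial queue
    provides the first step.\<close>
  have m: "m \<noteq> 0" using f assms(2) by (intro notI) auto
  define ss where "ss = map f [0..<Suc m]"
  have len: "length ss = Suc m" by (simp add: ss_def)
  have nth: "ss ! i = f i" if "i \<le> m" for i
    using that by (simp add: ss_def less_Suc_eq_le nth_append del: upt_Suc)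
  have "ss \<noteq> []" by (simp add: ss_def)
  then have hd: "hd ss = s" and last: "last ss = (model, [])"
    using nth[of 0] nth[of m] len f(1,2) by (simp_all add: hd_conv_nth last_conv_nth)
  have "terminating_chase_sequence T s ss"
    unfolding terminating_chase_sequence_def chase_sequence_def
    using len m hd last nth f(3) by auto
  moreover have "ss' = ss" if t: "terminating_chase_sequence T s ss'" for ss'
  proof -
    have ne: "ss' \<noteq> []" "snd (last ss') = []" and hd': "hd ss' = s"
      and step: "\<And>j. Suc j < length ss' \<Longrightarrow> chase_step T (fst s) (ss' ! j) (ss' ! Suc j)"
      using t by (auto simp: terminating_chase_sequence_def chase_sequence_def)
    have agree: "j \<le> m \<Longrightarrow> j < length ss' \<Longrightarrow> ss' ! j = f j" for j
    proof (induction j)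
      case 0
      then show ?case using hd' f(1) ne by (simp add: hd_conv_nth)
    next
      case (Suc j)
      then show ?case using step[of j] f(3)[of j] by (simp add: chase_step_def)
    qed
    have "\<not> Suc m < length ss'"
      using step[of m] agree[of m] f(2) by (auto simp: chase_step_def)
    moreover have "\<not> length ss' < Suc m"
    proof
      assume less: "length ss' < Suc m"
      obtain j where j: "length ss' = Suc j" using ne by (cases ss') auto
      then have "snd (f j) = []" using agree[of j] ne less by (simp add: last_conv_nth)
      then show False using f(3)[of j] j less by (simp add: chase_step_def)
    qed
    ultimately have "length ss' = Suc m" by simp
    then show ?thesis using agree nth len by (intro nth_equalityI) auto
  qed
  ultimately have "terminating_chase_sequence T s ss' \<longleftrightarrow> ss' = ss" for ss' by blast
  then show ?thesis using that len nth[of m] f(2) by simp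
qed

section \<open>Models of documents created once\<close>

text \<open>With no field ever set, each document has a single version and an empty body, so the
  forms in order of creation determine the model. Situations count from 0 and IDs from 1.\<close>

definition created_model :: "urelem list \<Rightarrow> elem list" where
  "created_model fs =
     map (\<lambda>j. Lst [num j, Ur (fs ! j), Lst [], num (Suc j)]) [0..<length fs]"

lemma num_eq_iff [simp]: "num m = num n \<longleftrightarrow> m = n"
  by (auto simp: num_def replicate_eq_replicate)

lemma length_created_model [simp]: "length (created_model fs) = length fs"
  by (simp add: created_model_def)

lemma version_ids_created_model:
  "version_ids (created_model fs) = map (\<lambda>j. num (Suc j)) [0..<length fs]"
  by (simp add: version_ids_def created_model_def map_filter_def o_def)

lemma created_model_snoc:
  "created_model (fs @ [f]) =
     created_model fs @ [Lst [num (length fs), Ur f, Lst [], num (Suc (length fs))]]"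
  by (simp add: created_model_def nth_append)

lemma last_id_created_model [simp]: "last_id (created_model fs) = length fs"
proof -
  have "{n. num n \<in> set (version_ids (created_model fs))} = {1..length fs}"
    by (auto simp: version_ids_created_model image_iff Bex_def gr0_conv_Suc Suc_le_eq)
  then have "last_id (created_model fs) = Max (insert 0 {1..length fs})"
    by (simp add: last_id_def)
  also have "insert 0 {1..length fs} = {0..length fs}" by auto
  also have "Max \<dots> = length fs" by (rule Max_eqI) auto
  finally show ?thesis .
qed

lemma last_version_created_model:
  assumes "j < length fs"
  shows "last_version (num (Suc j)) (created_model fs) =
    Some (Lst [num j, Ur (fs ! j), Lst [], num (Suc j)])"
  using assms
proof (induction fs rule: rev_induct)
  case (snoc f fs)
  then show ?case
    by (auto simp: last_version_def created_model_snoc nth_append less_Suc_eq)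
qed simp

lemma get_form_created_model:
  "j < length fs \<Longrightarrow> get_form (num (Suc j)) (created_model fs) = Ur (fs ! j)"
  by (simp add: get_form_def last_version_created_model)

text \<open>These are positions in \<open>fs\<close>; the ID of the document at position
  \<open>j\<close> is \<open>num (Suc j)\<close>.\<close>

definition ids_of_form :: "urelem list \<Rightarrow> urelem \<Rightarrow> nat list" where
  "ids_of_form fs f = filter (\<lambda>j. fs ! j = f) [0..<length fs]"

lemma length_ids_of_form: "length (ids_of_form fs f) = count_list fs f"
proof (induction fs rule: rev_induct)
  case (snoc x fs)
  have "filter (\<lambda>j. (fs @ [x]) ! j = f) [0..<length fs] = ids_of_form fs f"
    unfolding ids_of_form_def by (rule filter_cong) (auto simp: nth_append)
  with snoc show ?case by (simp add: ids_of_form_def)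
qed (simp add: ids_of_form_def)

section \<open>The theory\<close>

text \<open>Parity and offsets keep all names distinct, as \<open>document_theory\<close> demands:
  even from 2 for forms, odd from 3 for stages, 0 and 1 for \<open>double\<close> and
  \<open>every\<close>.\<close>

definition level :: "nat \<Rightarrow> urelem" where "level i = Name (2 * i + 2)"
definition stage :: "nat \<Rightarrow> urelem" where "stage i = Name (2 * i + 3)"
definition double :: urelem where "double = Name 0"
definition every :: urelem where "every = Name 1"

definition top_fml :: dfml where "top_fml = Equal Empty Empty"

text \<open>The last instruction of an extension is executed first.\<close>

definition stage_branch :: "nat \<Rightarrow> branch" where
  "stage_branch i = \<lparr>br_form = level 0, br_name = stage i, br_cond = top_fml,
     br_ext = [TransEach every Empty (level i) double Empty, CreateOne (level (Suc i))]\<rparr>"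

definition double_branch :: "nat \<Rightarrow> branch" where
  "double_branch i = \<lparr>br_form = level i, br_name = double, br_cond = top_fml,
     br_ext = [CreateEach every Empty (level (Suc i))]\<rparr>"

definition tower_theory :: "nat \<Rightarrow> doc_theory" where
  "tower_theory k = \<lparr>field_names = [], form_names = map level [0..<Suc k],
     filter_names = [every], trans_names = double # map stage [0..<k],
     cardinality = (\<lambda>_. (0, None)), blank_doc = (\<lambda>_. Lst []), filter_cond = (\<lambda>_. top_fml),
     trigger_branches = [],
     trans_branches = map stage_branch [0..<k] @ map double_branch [0..<k]\<rparr>"

text \<open>The document with ID 1 is the first one created and has form \<open>level 0\<close>,
  which is why every \<open>stage_branch\<close> is conditioned on \<open>level 0\<close>.\<close>

definition stage_instr :: "nat \<Rightarrow> elem" where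
  "stage_instr i = trans_instr (Lst []) (num (Suc 0)) (stage i)"

text \<open>The queue is consumed from its right end, hence the reversed stages. With
  \<open>Suc n\<close> creations the document with ID 1 exists even for
  \<open>n = 0\<close>.\<close>

definition tower_queue :: "nat \<Rightarrow> nat \<Rightarrow> elem list" where
  "tower_queue k n = map stage_instr (rev [0..<k]) @ replicate (Suc n) (create_instr (level 0))"

lemmas name_defs = level_def stage_def double_def every_def

lemma level_eq_iff [simp]: "level i = level j \<longleftrightarrow> i = j"
  by (simp add: level_def)

lemma stage_eq_iff [simp]: "stage i = stage j \<longleftrightarrow> i = j"
  by (simp add: stage_def)

lemma stage_neq_double [simp]: "stage i \<noteq> double" "double \<noteq> stage i"
  by (simp_all add: name_defs)

lemma names_not_CreateDoc [simp]:
  "double \<noteq> CreateDoc" "stage i \<noteq> CreateDoc" "CreateDoc \<noteq> double" "CreateDoc \<noteq> stage i"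
  by (simp_all add: name_defs)

section \<open>Well-formedness and acyclicity\<close>

lemma document_theory_tower: "document_theory (tower_theory k)"
proof -
  have "level i \<noteq> stage j" for i j
    unfolding level_def stage_def by (simp, presburger)
  then have "distinct (CreateDoc # SetField # map level [0..<Suc k] @ [every] @ double # map stage [0..<k])"
    by (auto simp: distinct_map inj_on_def name_defs simp del: upt_Suc)
  then show ?thesis
    by (auto simp: document_theory_def tower_theory_def blank_doc_ok_def branch_ok_def
        stage_branch_def double_branch_def top_fml_def trans_vars_def filter_vars_def
        simp del: upt_Suc)
qed

lemma locally_simple_tower: "locally_simple (tower_theory k)"
proof -
  \<comment> \<open>Every edge lowers the rank, whatever the forms. \<open>measure\<close> puts the
    smaller element first, so it contains the converse of the graph.\<close>
  define rank where "rank = (\<lambda>(f :: urelem, x).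
    if x = CreateDoc then 0 else if x = double then 1 else 2 :: nat)"
  have "(dependency_graph (tower_theory k))\<inverse> \<subseteq> measure rank"
    by (auto simp: dependency_graph_def tower_theory_def stage_branch_def double_branch_def rank_def)
  then have "acyclic ((dependency_graph (tower_theory k))\<inverse>)"
    by (meson wf_acyclic wf_measure wf_subset)
  then show ?thesis by (simp add: locally_simple_def acyclic_converse)
qed

section \<open>Linear size bounds\<close>

lemma length_commas: "length (commas xs) \<le> sum_list (map length xs) + length xs"
  by (induction xs rule: commas.induct) auto

lemma sum_list_map_le:
  assumes "\<And>x. x \<in> set xs \<Longrightarrow> f x \<le> (c::nat)"
  shows "sum_list (map f xs) \<le> c * length xs"
  using assms by (induction xs) (auto intro: add_mono)

lemma length_names_axiom: "length (names_axiom s ns) \<le> 2 * length ns + 4"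
  using length_commas[of "map (\<lambda>n. [ConstT n]) ns"]
  by (simp add: names_axiom_def tuple_str_def o_def sum_list_triv)

lemmas str_defs = app_str_def infix_str_def tuple_str_def form_cond_str_def filter_str_def
  rec_str_def branch_str_def daemon_axiom_def blank_doc_axiom_def filter_axiom_def

text \<open>A name is one token, so each branch, blank document axiom and filter axiom has bounded
  length. What grows with \<open>k\<close>, linearly, is the number of branches, of forms and of
  listed names.\<close>

lemma theory_size_tower: "\<exists>c. \<forall>k. theory_size (tower_theory k) \<le> c * Suc k"
proof -
  let ?T = tower_theory
  obtain b where b: "length (branch_str TransV (stage_branch i)) \<le> b"
    "length (branch_str TransV (double_branch i)) \<le> b" for i
  proof -
    \<comment> \<open>The numeric bounds are rough; what matters is that they are independent of
      \<open>i\<close> and \<open>k\<close>.\<close>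
    have "length (branch_str TransV (stage_branch i)) \<le> 1000"
      "length (branch_str TransV (double_branch i)) \<le> 1000" for i
      by (simp_all add: str_defs stage_branch_def double_branch_def top_fml_def)
    with that show ?thesis by blast
  qed
  have daemon: "length (daemon_axiom ''ExecTrans'' [TransV, DocIDV, ParamsV, QueueV, ModelV] TransV
      (trans_branches (?T k))) \<le> 2 * b * k + 100" for k
    using sum_list_map_le[of "[0..<k]" "\<lambda>i. length (branch_str TransV (stage_branch i))" b]
      sum_list_map_le[of "[0..<k]" "\<lambda>i. length (branch_str TransV (double_branch i))" b] b
    by (simp add: daemon_axiom_def app_str_def tower_theory_def length_concat o_def)
  have trig: "length (daemon_axiom ''SetFieldTrigger'' [DocIDV, FieldV, ValueV, QueueV, ModelV] FieldV
      (trigger_branches (?T k))) \<le> 100" for k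
    by (simp add: str_defs tower_theory_def)
  have filt: "length (filter_axiom (?T k) f) \<le> 200" for k f
    by (simp add: str_defs tower_theory_def top_fml_def)
  have blank: "length (blank_doc_axiom (?T k) f) \<le> 10" for k f
    by (simp add: str_defs tower_theory_def)
  have "theory_size (?T k) \<le> (2 * b + 1000) * Suc k" for k
  proof -
    have "theory_size (?T k) = length (names_axiom ''FieldNames'' []) +
        length (names_axiom ''FormNames'' (map level [0..<Suc k])) +
        length (names_axiom ''FilterNames'' [every]) +
        length (names_axiom ''TransNames'' (double # map stage [0..<k])) +
        sum_list (map (\<lambda>i. length (blank_doc_axiom (?T k) (level i))) [0..<Suc k]) +
        length (filter_axiom (?T k) every) +
        length (daemon_axiom ''SetFieldTrigger'' [DocIDV, FieldV, ValueV, QueueV, ModelV] FieldV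
          (trigger_branches (?T k))) +
        length (daemon_axiom ''ExecTrans'' [TransV, DocIDV, ParamsV, QueueV, ModelV] TransV
          (trans_branches (?T k)))"
    proof -
      have "field_names (?T k) = []" "form_names (?T k) = map level [0..<Suc k]"
        "filter_names (?T k) = [every]" "trans_names (?T k) = double # map stage [0..<k]"
        by (simp_all add: tower_theory_def)
      then show ?thesis by (simp add: theory_size_def axioms_def o_def del: upt_Suc)
    qed
    also have "\<dots> \<le> (2 * b + 1000) * Suc k"
      using length_names_axiom[of "''FieldNames''" "[]"]
        length_names_axiom[of "''FormNames''" "map level [0..<Suc k]"]
        length_names_axiom[of "''FilterNames''" "[every]"]
        length_names_axiom[of "''TransNames''" "double # map stage [0..<k]"]
        sum_list_map_le[of "[0..<Suc k]" "\<lambda>i. length (blank_doc_axiom (?T k) (level i))" 10]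
        filt[of k every] trig[of k] daemon[of k] blank
      by (simp add: algebra_simps del: upt_Suc)
    finally show ?thesis .
  qed
  then show ?thesis by blast
qed

lemma list_size_tower: "list_size (tower_queue k n) \<le> 50 * (k + Suc n)"
proof -
  let ?q = "tower_queue k n"
  have q: "length ?q = k + Suc n" by (simp add: tower_queue_def)
  have "length (elem_str x) \<le> 40" if "x \<in> set ?q" for x
    using that by (auto simp: tower_queue_def stage_instr_def trans_instr_def create_instr_def
        num_def tuple_str_def)
  then have "sum_list (map (\<lambda>x. length (elem_str x)) ?q) \<le> 40 * (k + Suc n)"
    using sum_list_map_le[of ?q "\<lambda>x. length (elem_str x)" 40] q by simp
  then show ?thesis
    using length_commas[of "map elem_str ?q"] q
    by (simp add: list_size_def tuple_str_def o_def)
qed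

section \<open>The chase\<close>

lemma blank_doc_tower [simp]: "blank_doc (tower_theory k) f = Lst []"
  by (simp add: tower_theory_def)

text \<open>The filter condition is trivially true, so only the form selects. The IDs are distinct,
  so \<open>remdups\<close> leaves them in order of creation.\<close>

lemma docs_by_filter_tower:
  "docs_by_filter (tower_theory k) flt f (created_model fs) p =
     map (\<lambda>j. num (Suc j)) (ids_of_form fs f)"
proof -
  have "last_version_ids (created_model fs) = map (\<lambda>j. num (Suc j)) [0..<length fs]"
    by (simp add: last_version_ids_def version_ids_created_model distinct_map inj_on_def
        distinct_remdups_id)
  then show ?thesis
    by (auto simp: docs_by_filter_def tower_theory_def top_fml_def ids_of_form_def filter_map o_def
        get_form_created_model intro!: arg_cong[where f="map _"] filter_cong)
qed

abbreviation reaches :: "nat \<Rightarrow> state \<Rightarrow> state \<Rightarrow> bool" where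
  "reaches k \<equiv> (chase_step (tower_theory k) [])\<^sup>*\<^sup>*"

lemma step_create:
  assumes "i \<le> k"
  shows "chase_step (tower_theory k) [] (created_model fs, q @ [create_instr (level i)])
    (created_model (fs @ [level i]), q)"
proof -
  have "level i \<in> set (form_names (tower_theory k))"
    using assms by (auto simp: tower_theory_def simp del: upt_Suc)
  then show ?thesis
    by (simp add: chase_step_def update_step_def create_instr_def create_doc_def created_model_snoc)
qed

lemma reaches_create:
  assumes "i \<le> k"
  shows "reaches k (created_model fs, q @ replicate n (create_instr (level i)))
    (created_model (fs @ replicate n (level i)), q)"
proof (induction n arbitrary: fs)
  case (Suc n)
  have "reaches k (created_model fs, (q @ replicate n (create_instr (level i))) @ [create_instr (level i)])
      (created_model (fs @ [level i]), q @ replicate n (create_instr (level i)))"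
    using step_create[OF assms] by blast
  also have "reaches k \<dots> (created_model ((fs @ [level i]) @ replicate n (level i)), q)"
    by (rule Suc)
  finally show ?case by (simp add: replicate_append_same)
qed simp

text \<open>Form and name determine a branch of \<open>tower_theory\<close>, and its additional
  condition always holds, so \<open>Cond_unique\<close> evaluates the daemon.\<close>

lemma step_trans:
  assumes "b \<in> set (trans_branches (tower_theory k))"
    and "j < length fs" "fs ! j = br_form b"
  shows "chase_step (tower_theory k) []
    (created_model fs, q @ [trans_instr p (num (Suc j)) (br_name b)])
    (created_model fs, q @ extension (tower_theory k) (created_model fs)
       (empty_env(TransV := Ur (br_name b), DocIDV := num (Suc j), ParamsV := p, QueueV := Lst q,
         ModelV := Lst (created_model fs))) (br_ext b))"
proof -
  let ?T = "tower_theory k"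
  have tr: "br_name b \<in> set (trans_names ?T)" "br_name b \<noteq> CreateDoc" "br_name b \<noteq> SetField"
    using assms(1)
    by (auto simp: tower_theory_def stage_branch_def double_branch_def name_defs)
  have unique: "b' = b" if "b' \<in> set (trans_branches ?T)" "br_form b' = br_form b" "br_name b' = br_name b" for b'
    using that assms(1) by (auto simp: tower_theory_def stage_branch_def double_branch_def)
  have holds: "holds e (br_cond b')" if "b' \<in> set (trans_branches ?T)" for e b'
    using that by (auto simp: tower_theory_def stage_branch_def double_branch_def top_fml_def)
  have id: "num (Suc j) \<in> set (version_ids (created_model fs))"
    using assms(2) by (auto simp: version_ids_created_model)
  have upd: "update_step ?T [] (created_model fs) (q @ [trans_instr p (num (Suc j)) (br_name b)]) =
      (created_model fs, exec_trans ?T (br_name b) (num (Suc j)) p q (created_model fs))"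
    using tr id by (auto simp: update_step_def trans_instr_def split: elem.split urelem.split)
  have "exec_trans ?T (br_name b) (num (Suc j)) p q (created_model fs) =
      q @ extension ?T (created_model fs)
       (empty_env(TransV := Ur (br_name b), DocIDV := num (Suc j), ParamsV := p, QueueV := Lst q,
         ModelV := Lst (created_model fs))) (br_ext b)"
    unfolding exec_trans_def Let_def get_form_created_model[OF assms(2)] assms(3)
  proof (rule Cond_unique, goal_cases)
    case 1
    then show ?case unfolding set_map by (rule image_eqI[OF _ assms(1)]) (simp add: holds assms(1))
  next
    case (2 y)
    then obtain b' where "b' \<in> set (trans_branches ?T)" "br_form b' = br_form b" "br_name b' = br_name b"
      and y: "y = q @ extension ?T (created_model fs)
       (empty_env(TransV := Ur (br_name b), DocIDV := num (Suc j), ParamsV := p, QueueV := Lst q,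
         ModelV := Lst (created_model fs))) (br_ext b')" by auto
    then show ?case using unique by blast
  qed
  then show ?thesis by (simp add: chase_step_def upd)
qed

text \<open>The instructions are issued for documents known when the stage starts; later documents only
  extend the list \<open>fs\<close>, so the premise on \<open>js\<close> persists.\<close>

lemma reaches_double:
  assumes "i < k" "\<forall>j \<in> set js. j < length fs \<and> fs ! j = level i"
  shows "\<exists>gs. reaches k
    (created_model fs, q @ map (\<lambda>j. trans_instr (Lst []) (num (Suc j)) double) js)
    (created_model (fs @ gs), q) \<and>
    count_list (fs @ gs) (level (Suc i)) = 2 ^ length js * count_list fs (level (Suc i))"
  using assms(2)
\<comment> \<open>The rightmost transaction runs first, hence the induction from the right;
  \<open>fs\<close> varies because that transaction enlarges the model.\<close>
proof (induction js arbitrary: fs rule: rev_induct)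
  case Nil
  have "reaches k (created_model fs, q) (created_model (fs @ []), q)" by simp
  then show ?case by (intro exI[of _ "[]"]) simp
next
  case (snoc j js)
  let ?c = "count_list fs (level (Suc i))"
  let ?q = "q @ map (\<lambda>j. trans_instr (Lst []) (num (Suc j)) double) js"
  \<comment> \<open>The filter sees the \<open>?c\<close> target documents present at this moment,
    and as many new ones are created: one doubling.\<close>
  let ?hs = "replicate ?c (level (Suc i))"
  have branch: "double_branch i \<in> set (trans_branches (tower_theory k))"
    using assms(1) by (simp add: tower_theory_def)
  have "chase_step (tower_theory k) []
      (created_model fs, ?q @ [trans_instr (Lst []) (num (Suc j)) double])
      (created_model fs, ?q @ replicate ?c (create_instr (level (Suc i))))"
    using step_trans[OF branch, of j fs ?q "Lst []"] snoc.prems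
    by (simp add: double_branch_def extension_def Rec_append_singleton docs_by_filter_tower
        length_ids_of_form map_replicate_const)
  note r_into_rtranclp[of "chase_step (tower_theory k) []", OF this]
  also have "reaches k \<dots> (created_model (fs @ ?hs), ?q)"
    using assms(1) by (intro reaches_create) simp
  finally have first: "reaches k
      (created_model fs, ?q @ [trans_instr (Lst []) (num (Suc j)) double])
      (created_model (fs @ ?hs), ?q)" by simp
  obtain gs where gs: "reaches k (created_model (fs @ ?hs), ?q) (created_model ((fs @ ?hs) @ gs), q)"
    "count_list ((fs @ ?hs) @ gs) (level (Suc i)) =
       2 ^ length js * count_list (fs @ ?hs) (level (Suc i))"
  proof -
    have "\<forall>j \<in> set js. j < length (fs @ ?hs) \<and> (fs @ ?hs) ! j = level i"
      using snoc.prems by (auto simp: nth_append)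
    then show ?thesis using snoc.IH[of "fs @ ?hs"] that by blast
  qed
  show ?case
    using rtranclp_trans[OF first gs(1)] gs(2)
    by (intro exI[of _ "?hs @ gs"]) (simp add: count_list_replicate)
qed

text \<open>The creation, executed first, makes the count of \<open>level (Suc i)\<close> positive;
  then it doubles once for each document of form \<open>level i\<close>. Only an inequality results,
  since \<open>fs\<close> may already contain documents of form
  \<open>level (Suc i)\<close>.\<close>

lemma reaches_stage:
  assumes "i < k" "fs \<noteq> []" "hd fs = level 0"
  shows "\<exists>gs. reaches k (created_model fs, q @ [stage_instr i]) (created_model (fs @ gs), q) \<and>
    2 ^ count_list fs (level i) \<le> count_list (fs @ gs) (level (Suc i))"
proof -
  let ?js = "ids_of_form fs (level i)" and ?fs = "fs @ [level (Suc i)]"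
  let ?q = "q @ map (\<lambda>j. trans_instr (Lst []) (num (Suc j)) double) ?js"
  have branch: "stage_branch i \<in> set (trans_branches (tower_theory k))"
    using assms(1) by (simp add: tower_theory_def)
  have "chase_step (tower_theory k) [] (created_model fs, q @ [stage_instr i])
      (created_model fs, ?q @ [create_instr (level (Suc i))])"
    using step_trans[OF branch, of 0 fs q "Lst []"] assms
    by (simp add: stage_branch_def extension_def Rec_append_singleton docs_by_filter_tower
        stage_instr_def hd_conv_nth o_def)
  moreover have "chase_step (tower_theory k) [] (created_model fs, ?q @ [create_instr (level (Suc i))])
      (created_model ?fs, ?q)"
    using assms(1) by (intro step_create) simp
  moreover have "\<forall>j \<in> set ?js. j < length ?fs \<and> ?fs ! j = level i"
    by (auto simp: ids_of_form_def nth_append)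
  then obtain gs where gs: "reaches k (created_model ?fs, ?q) (created_model (?fs @ gs), q)"
    "count_list (?fs @ gs) (level (Suc i)) = 2 ^ length ?js * count_list ?fs (level (Suc i))"
    using reaches_double[OF assms(1), of ?js ?fs q] by blast
  ultimately have "reaches k (created_model fs, q @ [stage_instr i]) (created_model (?fs @ gs), q)"
    by (meson converse_rtranclp_into_rtranclp)
  then show ?thesis
    using gs(2) by (intro exI[of _ "level (Suc i) # gs"]) (simp add: length_ids_of_form)
qed

text \<open>Induction on the number of completed stages. The facts on \<open>fs \<noteq> []\<close>
  and \<open>hd fs\<close> preserve the form of the document with ID 1, on which all remaining
  stages run.\<close>

lemma reaches_stages:
  assumes "i \<le> k"
  shows "\<exists>fs. reaches k ([], tower_queue k n) (created_model fs, map stage_instr (rev [i..<k])) \<and>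
    fs \<noteq> [] \<and> hd fs = level 0 \<and> iter_exp i n \<le> count_list fs (level i)"
  using assms
proof (induction i)
  case 0
  show ?case
    using reaches_create[of 0 k "[]" "map stage_instr (rev [0..<k])" "Suc n"]
    by (intro exI[of _ "replicate (Suc n) (level 0)"])
      (simp_all add: tower_queue_def created_model_def count_list_replicate)
next
  case (Suc i)
  then obtain fs where fs: "reaches k ([], tower_queue k n) (created_model fs, map stage_instr (rev [i..<k]))"
    "fs \<noteq> []" "hd fs = level 0" "iter_exp i n \<le> count_list fs (level i)" by auto
  have q: "map stage_instr (rev [i..<k]) = map stage_instr (rev [Suc i..<k]) @ [stage_instr i]"
    using Suc.prems by (simp add: upt_conv_Cons)
  obtain gs where gs: "reaches k (created_model fs, map stage_instr (rev [i..<k]))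
      (created_model (fs @ gs), map stage_instr (rev [Suc i..<k]))"
    "2 ^ count_list fs (level i) \<le> count_list (fs @ gs) (level (Suc i))"
    using reaches_stage[of i k fs] Suc.prems fs unfolding q by (metis Suc_le_eq)
  have "iter_exp (Suc i) n \<le> 2 ^ count_list fs (level i)" using fs(4) by simp
  then have "iter_exp (Suc i) n \<le> count_list (fs @ gs) (level (Suc i))"
    using gs(2) by (rule le_trans)
  moreover have "reaches k ([], tower_queue k n)
      (created_model (fs @ gs), map stage_instr (rev [Suc i..<k]))"
    using fs(1) gs(1) by (rule rtranclp_trans)
  ultimately show ?case using fs(2,3) by (intro exI[of _ "fs @ gs"]) simp
qed

theorem theorem3:
  shows "\<exists>c::nat. \<forall>k n::nat. 1 \<le> k \<longrightarrow>
    (\<exists>T queue. document_theory T \<and> locally_simple T \<and>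
       theory_size T \<le> c * (k + n) \<and> list_size queue \<le> c * (k + n) \<and>
       (\<exists>ss m model.
          (\<forall>ss'. terminating_chase_sequence T ([], queue) ss' \<longleftrightarrow> ss' = ss) \<and>
          length ss = Suc m \<and> iter_exp k n \<le> m \<and>
          ss ! m = (model, []) \<and> iter_exp k n \<le> length model))"
proof -
  obtain c where c: "\<And>k. theory_size (tower_theory k) \<le> c * Suc k"
    using theory_size_tower by blast
  show ?thesis
  \<comment> \<open>As \<open>k \<ge> 1\<close>, \<open>Suc k \<le> 2 * (k + n)\<close> and
    \<open>50 * (k + Suc n) \<le> 100 * (k + n)\<close>; these give the two summands.\<close>
  proof (intro exI[of _ "2 * c + 100"] allI impI)
    fix k n :: nat
    assume k: "1 \<le> k"
    let ?T = "tower_theory k" and ?q = "tower_queue k n"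
    have "c * Suc k \<le> c * (2 * (k + n))" using k by (intro mult_le_mono2) simp
    then have size: "theory_size ?T \<le> (2 * c + 100) * (k + n)"
      using c[of k] by (simp add: algebra_simps)
    have qsize: "list_size ?q \<le> (2 * c + 100) * (k + n)"
      using list_size_tower[of k n] k by (simp add: algebra_simps)
    obtain fs where fs: "reaches k ([], ?q) (created_model fs, [])"
      "iter_exp k n \<le> count_list fs (level k)"
      using reaches_stages[of k k n] by auto
    then obtain m where m: "(chase_step ?T [] ^^ m) ([], ?q) (created_model fs, [])"
      by (auto simp: rtranclp_power)
    have len: "iter_exp k n \<le> length fs"
      using fs(2) count_le_length[of fs "level k"] by linarith
    \<comment> \<open>The chase starts from the empty model, so the lower bound on the final model
      carries over to the number of steps.\<close>
    have "length fs \<le> m" using length_chase_steps[OF m] by simp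
    moreover obtain ss where "\<And>ss'. terminating_chase_sequence ?T ([], ?q) ss' \<longleftrightarrow> ss' = ss"
      "length ss = Suc m" "ss ! m = (created_model fs, [])"
      using unique_terminating_chase[where T="?T" and s="([], ?q)" and m=m and model="created_model fs"] m
      by (auto simp: tower_queue_def)
    ultimately show "\<exists>T queue. document_theory T \<and> locally_simple T \<and>
       theory_size T \<le> (2 * c + 100) * (k + n) \<and> list_size queue \<le> (2 * c + 100) * (k + n) \<and>
       (\<exists>ss m model.
          (\<forall>ss'. terminating_chase_sequence T ([], queue) ss' \<longleftrightarrow> ss' = ss) \<and>
          length ss = Suc m \<and> iter_exp k n \<le> m \<and>
          ss ! m = (model, []) \<and> iter_exp k n \<le> length model)"
      using document_theory_tower locally_simple_tower size qsize len
      by (intro exI[of _ ?T] exI[of _ ?q] conjI exI[of _ ss] exI[of _ m] exI[of _ "created_model fs"])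
        auto
  qed
qed

end
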